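(* Let $\alpha_1,\alpha_2,\alpha_3,\beta_1,\beta_2\in\mathbb{R}$ be arbitrary constants with $\beta_2\neq 0$, and let $$M=\begin{pmatrix}\alpha_1 q\partial^{-1}q & \alpha_2+\alpha_3\partial-\alpha_1 q\partial^{-1}r\\ -\alpha_2+\alpha_3\partial-\alpha_1 r\partial^{-1}q & \alpha_1 r\partial^{-1}r\end{pmatrix},\qquad J=\begin{pmatrix}\beta_1 q\partial^{-1}q & \beta_2-\beta_1 q\partial^{-1}r\\ -\beta_2-\beta_1 r\partial^{-1}q & \beta_1 r\partial^{-1}r\end{pmatrix}.$$ Then $J$ and $M$ constitute a Hamiltonian pair, $J$ is invertible with inverse $$J^{-1}=\frac1{\beta_2^2}\begin{pmatrix}\beta_1 r\partial^{-1}r & -\beta_2+\beta_1 r\partial^{-1}q\\ \beta_2+\beta_1 q\partial^{-1}r & \beta_1 q\partial^{-1}q\end{pmatrix},$$ and the operator $\Phi=MJ^{-1}$ is a hereditary symmetry operator, given explicitly by $\Phi=\frac{1}{\beta_2^2}\begin{pmatrix}\Phi_{11}&\Phi_{12}\\ \Phi_{21}&\Phi_{22}\end{pmatrix}$ with $$\Phi_{11}=\alpha_2\beta_2+\alpha_3\beta_2\partial+(\alpha_2\beta_1-\alpha_1\beta_2)q\partial^{-1}r+\alpha_3\beta_1\partial q\partial^{-1}r,$$ $$\Phi_{12}=(\alpha_2\beta_1-\alpha_1\beta_2)q\partial^{-1}q+\alpha_3\beta_1\partial q\partial^{-1}q,$$ $$\Phi_{21}=(\alpha_1\beta_2-\alpha_2\beta_1)r\partial^{-1}r+\alpha_3\beta_1\partial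 r\partial^{-1}r,$$ $$\Phi_{22}=\alpha_2\beta_2-\alpha_3\beta_2\partial+(\alpha_1\beta_2-\alpha_2\beta_1)r\partial^{-1}q+\alpha_3\beta_1\partial r\partial^{-1}q.$$
   Context: Here $u=(q,r)^T$ with $q=q(x)$, $r=r(x)$ real functions, $\partial=\partial/\partial x$, and $\partial^{-1}$ is its skew-symmetric inverse. Concretely: all functions and all components of vector functions are smooth and rapidly decreasing (Schwartz) in $x\in\mathbb{R}$, and $(\partial^{-1}f)(x)=\frac12\left(\int_{-\infty}^x f-\int_x^{\infty}f\right)$, so $\partial^{-1}\partial f=f$ for Schwartz $f$ (zero integration constants). In expressions such as $q\partial^{-1}r$ or $\partial q\partial^{-1}r$, the letters $q,r$ denote multiplication operators and juxtaposition denotes composition of operators. $\langle\cdot,\cdot\rangle$ is the standard inner product of $\mathbb{R}^2$. The Gateaux derivative of an operator $A(u)$ in direction $W$ is $A'[W]=\frac{d}{d\varepsilon}\big|_{\varepsilon=0}A(u+\varepsilon W)$. A linear operator $A=A(u)$ is Hamiltonian if it is skew-symmetric with respect to $\int\langle\cdot,\cdot\rangle dx$ and satisfies the Jacobi identity: $\langle Z,A'[AX]Y\rangle+\langle X,A'[AY]Z\rangle+\langle Y,A'[AZ]X\rangle$ has zero integral over $\mathbb{R}$ (is a total derivative) for all two-component vector functions $X,Y,Z$. Two operators $J,M$ form a Hamiltonian pair if every linear combination $aJ+bM$ with constants $a,b$ is Hamiltonian. A linear operator $\Phi=\Phi(u)$ is a hereditary symmetry operator if $$\Phi'[\Phi X]Y-\Phi\,\Phi'[X]Y=\Phi'[\Phi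 Y]X-\Phi\,\Phi'[Y]X$$ for all two-component vector functions $X,Y$ and all $u$. *)

theory Defs
  imports "HOL-Analysis.Analysis" "HOL-Library.Function_Algebras"
begin

text \<open>
  Sums and differences of functions and of operators are pointwise (Function_Algebras).
\<close>

type_synonym scalar_fun = "real \<Rightarrow> real"
type_synonym vector_fun = "real \<Rightarrow> real \<times> real"
type_synonym scalar_op = "scalar_fun \<Rightarrow> scalar_fun"
type_synonym vector_op = "vector_fun \<Rightarrow> vector_fun"

definition schwartz :: "scalar_fun \<Rightarrow> bool" where
  "schwartz f \<longleftrightarrow>
     (\<forall>n. (deriv ^^ n) f differentiable_on UNIV) \<and>
     (\<forall>k n. bounded (range (\<lambda>x. x ^ k * (deriv ^^ n) f x)))"

definition S2 :: "vector_fun set" where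
  "S2 = {X. schwartz (\<lambda>x. fst (X x)) \<and> schwartz (\<lambda>x. snd (X x))}"

definition vscale :: "real \<Rightarrow> vector_fun \<Rightarrow> vector_fun" where
  "vscale c X = (\<lambda>x. c *\<^sub>R X x)"

definition Dinv :: scalar_op where
  "Dinv f = (\<lambda>x. ((LBINT t:{..x}. f t) - (LBINT t:{x..}. f t)) / 2)"

definition mult :: "scalar_fun \<Rightarrow> scalar_op" where
  "mult q f = (\<lambda>x. q x * f x)"

text \<open>A real constant, read as an operator, is multiplication by that constant.\<close>

definition const :: "real \<Rightarrow> scalar_op" where
  "const c f = (\<lambda>x. c * f x)"

text \<open>Composition of scalar operators, binding tighter than sums of operators.\<close>

abbreviation op_comp :: "scalar_op \<Rightarrow> scalar_op \<Rightarrow> scalar_op" (infixl "\<odot>" 70) where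
  "A \<odot> B \<equiv> A \<circ> B"

definition matrix_op :: "scalar_op \<Rightarrow> scalar_op \<Rightarrow> scalar_op \<Rightarrow> scalar_op \<Rightarrow> vector_op" where
  "matrix_op A11 A12 A21 A22 X =
     (let f = (\<lambda>x. fst (X x)); g = (\<lambda>x. snd (X x))
      in (\<lambda>x. ((A11 f + A12 g) x, (A21 f + A22 g) x)))"

text \<open>
  An operator \<open>A = A(u)\<close> is a function of the potential \<open>u = (q, r)\<close>.  Only its values for
  \<open>u\<close> and arguments in \<open>S2\<close> are relevant.
\<close>

definition linear_op :: "(vector_fun \<Rightarrow> vector_op) \<Rightarrow> bool" where
  "linear_op A \<longleftrightarrow>
     (\<forall>u\<in>S2. \<forall>X\<in>S2. A u X \<in> S2) \<and>
     (\<forall>u\<in>S2. \<forall>X\<in>S2. \<forall>Y\<in>S2. \<forall>a b.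
        A u (vscale a X + vscale b Y) = vscale a (A u X) + vscale b (A u Y))"

definition gateaux :: "(vector_fun \<Rightarrow> vector_op) \<Rightarrow> vector_fun \<Rightarrow> vector_fun \<Rightarrow> vector_op" where
  "gateaux A u W Y = (\<lambda>x. vector_derivative (\<lambda>\<epsilon>. A (u + vscale \<epsilon> W) Y x) (at 0))"

text \<open>
  Since \<open>vector_derivative\<close> is total, existence of the derivative is required separately.
\<close>

definition gateaux_differentiable :: "(vector_fun \<Rightarrow> vector_op) \<Rightarrow> bool" where
  "gateaux_differentiable A \<longleftrightarrow>
     (\<forall>u\<in>S2. \<forall>W\<in>S2. \<forall>Y\<in>S2.
        (\<forall>x. (\<lambda>\<epsilon>. A (u + vscale \<epsilon> W) Y x) differentiable (at 0)) \<and>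
        gateaux A u W Y \<in> S2)"

definition pairing :: "vector_fun \<Rightarrow> vector_fun \<Rightarrow> real" where
  "pairing X Y = (LBINT x. X x \<bullet> Y x)"

definition skew_symmetric :: "(vector_fun \<Rightarrow> vector_op) \<Rightarrow> bool" where
  "skew_symmetric A \<longleftrightarrow>
     (\<forall>u\<in>S2. \<forall>X\<in>S2. \<forall>Y\<in>S2. pairing (A u X) Y = - pairing X (A u Y))"

definition jacobi_identity :: "(vector_fun \<Rightarrow> vector_op) \<Rightarrow> bool" where
  "jacobi_identity A \<longleftrightarrow>
     (\<forall>u\<in>S2. \<forall>X\<in>S2. \<forall>Y\<in>S2. \<forall>Z\<in>S2.
        has_bochner_integral lborel
          (\<lambda>x. Z x \<bullet> gateaux A u (A u X) Y x
             + X x \<bullet> gateaux A u (A u Y) Z x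
             + Y x \<bullet> gateaux A u (A u Z) X x) 0)"

definition hamiltonian :: "(vector_fun \<Rightarrow> vector_op) \<Rightarrow> bool" where
  "hamiltonian A \<longleftrightarrow>
     linear_op A \<and> gateaux_differentiable A \<and> skew_symmetric A \<and> jacobi_identity A"

definition hamiltonian_pair ::
    "(vector_fun \<Rightarrow> vector_op) \<Rightarrow> (vector_fun \<Rightarrow> vector_op) \<Rightarrow> bool" where
  "hamiltonian_pair J M \<longleftrightarrow>
     (\<forall>a b. hamiltonian (\<lambda>u X. vscale a (J u X) + vscale b (M u X)))"

definition hereditary_symmetry :: "(vector_fun \<Rightarrow> vector_op) \<Rightarrow> bool" where
  "hereditary_symmetry \<Phi> \<longleftrightarrow>
     linear_op \<Phi> \<and> gateaux_differentiable \<Phi> \<and>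
     (\<forall>u\<in>S2. \<forall>X\<in>S2. \<forall>Y\<in>S2.
        gateaux \<Phi> u (\<Phi> u X) Y - \<Phi> u (gateaux \<Phi> u X Y) =
        gateaux \<Phi> u (\<Phi> u Y) X - \<Phi> u (gateaux \<Phi> u Y X))"

definition invertible_op :: "(vector_fun \<Rightarrow> vector_op) \<Rightarrow> bool" where
  "invertible_op A \<longleftrightarrow> (\<forall>u\<in>S2. bij_betw (A u) S2 S2)"

definition inverse_op :: "(vector_fun \<Rightarrow> vector_op) \<Rightarrow> vector_fun \<Rightarrow> vector_op" where
  "inverse_op A u = inv_into S2 (A u)"

definition M_op :: "real \<Rightarrow> real \<Rightarrow> real \<Rightarrow> vector_fun \<Rightarrow> vector_op" where
  "M_op \<alpha>1 \<alpha>2 \<alpha>3 u =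
     (let q = mult (\<lambda>x. fst (u x)); r = mult (\<lambda>x. snd (u x)) in
      matrix_op
        (const \<alpha>1 \<odot> q \<odot> Dinv \<odot> q)
        (const \<alpha>2 + const \<alpha>3 \<odot> deriv - const \<alpha>1 \<odot> q \<odot> Dinv \<odot> r)
        (const (- \<alpha>2) + const \<alpha>3 \<odot> deriv - const \<alpha>1 \<odot> r \<odot> Dinv \<odot> q)
        (const \<alpha>1 \<odot> r \<odot> Dinv \<odot> r))"

definition J_op :: "real \<Rightarrow> real \<Rightarrow> vector_fun \<Rightarrow> vector_op" where
  "J_op \<beta>1 \<beta>2 u =
     (let q = mult (\<lambda>x. fst (u x)); r = mult (\<lambda>x. snd (u x)) in
      matrix_op
        (const \<beta>1 \<odot> q \<odot> Dinv \<odot> q)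
        (const \<beta>2 - const \<beta>1 \<odot> q \<odot> Dinv \<odot> r)
        (const (- \<beta>2) - const \<beta>1 \<odot> r \<odot> Dinv \<odot> q)
        (const \<beta>1 \<odot> r \<odot> Dinv \<odot> r))"

definition J_inv_formula :: "real \<Rightarrow> real \<Rightarrow> vector_fun \<Rightarrow> vector_op" where
  "J_inv_formula \<beta>1 \<beta>2 u X =
     (let q = mult (\<lambda>x. fst (u x)); r = mult (\<lambda>x. snd (u x)) in
      vscale (1 / \<beta>2\<^sup>2) (matrix_op
        (const \<beta>1 \<odot> r \<odot> Dinv \<odot> r)
        (const (- \<beta>2) + const \<beta>1 \<odot> r \<odot> Dinv \<odot> q)
        (const \<beta>2 + const \<beta>1 \<odot> q \<odot> Dinv \<odot> r)
        (const \<beta>1 \<odot> q \<odot> Dinv \<odot> q) X))"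

definition Phi_op :: "real \<Rightarrow> real \<Rightarrow> real \<Rightarrow> real \<Rightarrow> real \<Rightarrow> vector_fun \<Rightarrow> vector_op" where
  "Phi_op \<alpha>1 \<alpha>2 \<alpha>3 \<beta>1 \<beta>2 u = M_op \<alpha>1 \<alpha>2 \<alpha>3 u \<circ> inverse_op (J_op \<beta>1 \<beta>2) u"

definition Phi_formula :: "real \<Rightarrow> real \<Rightarrow> real \<Rightarrow> real \<Rightarrow> real \<Rightarrow> vector_fun \<Rightarrow> vector_op" where
  "Phi_formula \<alpha>1 \<alpha>2 \<alpha>3 \<beta>1 \<beta>2 u X =
     (let q = mult (\<lambda>x. fst (u x)); r = mult (\<lambda>x. snd (u x)) in
      vscale (1 / \<beta>2\<^sup>2) (matrix_op
        (const (\<alpha>2 * \<beta>2) + const (\<alpha>3 * \<beta>2) \<odot> deriv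
           + const (\<alpha>2 * \<beta>1 - \<alpha>1 * \<beta>2) \<odot> q \<odot> Dinv \<odot> r
           + const (\<alpha>3 * \<beta>1) \<odot> deriv \<odot> q \<odot> Dinv \<odot> r)
        (const (\<alpha>2 * \<beta>1 - \<alpha>1 * \<beta>2) \<odot> q \<odot> Dinv \<odot> q
           + const (\<alpha>3 * \<beta>1) \<odot> deriv \<odot> q \<odot> Dinv \<odot> q)
        (const (\<alpha>1 * \<beta>2 - \<alpha>2 * \<beta>1) \<odot> r \<odot> Dinv \<odot> r
           + const (\<alpha>3 * \<beta>1) \<odot> deriv \<odot> r \<odot> Dinv \<odot> r)
        (const (\<alpha>2 * \<beta>2) - const (\<alpha>3 * \<beta>2) \<odot> deriv
           + const (\<alpha>1 * \<beta>2 - \<alpha>2 * \<beta>1) \<odot> r \<odot> Dinv \<odot> q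
           + const (\<alpha>3 * \<beta>1) \<odot> deriv \<odot> r \<odot> Dinv \<odot> q) X))"

end

(*
  With v = (q, -r), s = (r, q), P = diag(1, -1), sigma = ((0, 1), (-1, 0)) and
  tau = ((0, 1), (1, 0)), M = a1 v Dinv v^T + a2 sigma + a3 tau d, and J is the case without d;
  hence every linear combination of J and M is again of the form M.  In the Jacobi identity for M,
  integration by parts leaves a total derivative.  Multiplying out M J^-1 with v . s = 0 and
  sigma s = v gives Phi = k0 + k1 P d + (k2 P + k3 d) u Dinv s^T.  This is hereditary for all
  constants k0, ..., k3: modulo the commuting outer operator k2 P + k3 d, the nonlocal terms of the
  identity are Dinv of a total derivative and the remainder cancels pointwise.
*)

theory Submission
  imports Defs "HOL-Probability.Sinc_Integral"
begin

section \<open>Schwartz functions and bounded smooth functions\<close>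

text \<open>The obstacle is that \<open>Dinv\<close> leaves the Schwartz class:
  \<open>Dinv f\<close> tends to plus and minus half the integral of \<open>f\<close> at the two
  ends. Antiderivatives therefore live in the larger class of bounded smooth functions, and a
  product with one Schwartz factor is Schwartz again. The boundary terms of an integration by parts
  need not decay either. They contain products of two antiderivatives, and since both factors change
  sign from one end to the other, such a product has the same limit at both ends. This is enough for
  its derivative to have integral zero.\<close>

definition bounded_smooth :: "scalar_fun \<Rightarrow> bool" where
  "bounded_smooth f \<longleftrightarrow>
     (\<forall>n. (deriv ^^ n) f differentiable_on UNIV \<and> bounded (range ((deriv ^^ n) f)))"

text \<open>Takes the place of an induction on the order of differentiation: once a class of
  functions is closed under \<open>deriv\<close>, the estimates are needed for its members only, and
  no Leibniz formula for higher derivatives arises.\<close>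

lemma schwartz_coinduct:
  assumes "P f"
    and differentiable: "\<And>f. P f \<Longrightarrow> f differentiable_on UNIV"
    and decay: "\<And>f k. P f \<Longrightarrow> bounded (range (\<lambda>x. x ^ k * f x))"
    and deriv: "\<And>f. P f \<Longrightarrow> P (deriv f)"
  shows "schwartz f"
proof -
  have "P ((deriv ^^ n) f)" for n
    using assms(1) deriv by (induction n) auto
  then show ?thesis
    unfolding schwartz_def using differentiable decay by blast
qed

lemma bounded_smooth_coinduct:
  assumes "P f"
    and differentiable: "\<And>f. P f \<Longrightarrow> f differentiable_on UNIV"
    and bounded: "\<And>f. P f \<Longrightarrow> bounded (range f)"
    and deriv: "\<And>f. P f \<Longrightarrow> P (deriv f)"
  shows "bounded_smooth f"
proof -
  have "P ((deriv ^^ n) f)" for n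
    using assms(1) deriv by (induction n) auto
  then show ?thesis
    unfolding bounded_smooth_def using differentiable bounded by blast
qed

lemma schwartz_decay: "schwartz f \<Longrightarrow> bounded (range (\<lambda>x. x ^ k * f x))"
  unfolding schwartz_def by (metis funpow_0)

lemma schwartz_deriv: "schwartz f \<Longrightarrow> schwartz (deriv f)"
  unfolding schwartz_def by (metis funpow_Suc_right o_apply)

lemma bounded_smooth_differentiable: "bounded_smooth f \<Longrightarrow> f differentiable_on UNIV"
  unfolding bounded_smooth_def by (metis funpow_0)

lemma bounded_smooth_bounded: "bounded_smooth f \<Longrightarrow> bounded (range f)"
  unfolding bounded_smooth_def by (metis funpow_0)

lemma bounded_smooth_deriv: "bounded_smooth f \<Longrightarrow> bounded_smooth (deriv f)"
  unfolding bounded_smooth_def by (metis funpow_Suc_right o_apply)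

lemma schwartz_imp_bounded_smooth:
  assumes "schwartz f"
  shows "bounded_smooth f"
  using assms unfolding schwartz_def bounded_smooth_def
  by (metis (no_types, lifting) mult_1 power_0 image_cong)

lemma bounded_smooth_DERIV:
  "bounded_smooth f \<Longrightarrow> (f has_real_derivative deriv f x) (at x)"
  using bounded_smooth_differentiable[of f]
  by (auto simp: differentiable_on_def field_differentiable_derivI field_differentiable_def
      DERIV_deriv_iff_real_differentiable)

section \<open>Differentiation rules and closure under algebraic operations\<close>

lemma deriv_add_differentiable:
  fixes f g :: scalar_fun
  assumes "f differentiable_on UNIV" "g differentiable_on UNIV"
  shows "deriv (f + g) = deriv f + deriv g"
proof
  fix x show "deriv (f + g) x = (deriv f + deriv g) x"
    unfolding plus_fun_def
    using assms
    by (intro DERIV_imp_deriv DERIV_add)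
      (auto simp: DERIV_deriv_iff_real_differentiable differentiable_on_def)
qed

lemma deriv_fun_add:
  "bounded_smooth f \<Longrightarrow> bounded_smooth g \<Longrightarrow> deriv (f + g) = deriv f + deriv g"
  by (simp only: deriv_add_differentiable bounded_smooth_differentiable)

lemma deriv_fun_diff:
  assumes "bounded_smooth f" "bounded_smooth g"
  shows "deriv (f - g) = deriv f - deriv g"
proof
  fix x show "deriv (f - g) x = (deriv f - deriv g) x"
    unfolding fun_diff_def
    by (intro DERIV_imp_deriv DERIV_diff bounded_smooth_DERIV assms)
qed

lemma deriv_fun_mult:
  assumes "bounded_smooth f" "bounded_smooth g"
  shows "deriv (f * g) = deriv f * g + f * deriv g"
proof
  fix x
  have "((\<lambda>x. f x * g x) has_real_derivative deriv f x * g x + deriv g x * f x) (at x)"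
    by (intro DERIV_mult bounded_smooth_DERIV assms)
  then show "deriv (f * g) x = (deriv f * g + f * deriv g) x"
    by (simp add: times_fun_def plus_fun_def DERIV_imp_deriv mult.commute)
qed

lemma deriv_fun_const:
  assumes "bounded_smooth f"
  shows "deriv (const c f) = const c (deriv f)"
proof
  fix x show "deriv (const c f) x = const c (deriv f) x"
    unfolding const_def
    by (intro DERIV_imp_deriv DERIV_cmult bounded_smooth_DERIV assms)
qed

lemma differentiable_fun_ops:
  fixes f g :: scalar_fun
  assumes "f differentiable_on UNIV" "g differentiable_on UNIV"
  shows "f + g differentiable_on UNIV" "f * g differentiable_on UNIV"
    "const c f differentiable_on UNIV"
  using assms unfolding plus_fun_def times_fun_def const_def
  by (auto intro!: derivative_intros)

lemma bounded_range_times: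
  fixes f g :: scalar_fun
  assumes "bounded (range f)" "bounded (range g)"
  shows "bounded (range (\<lambda>x. f x * g x))"
proof -
  obtain a b where "\<And>x. \<bar>f x\<bar> \<le> a" "\<And>x. \<bar>g x\<bar> \<le> b"
    using assms by (auto simp: bounded_iff)
  then have "\<bar>f x * g x\<bar> \<le> a * b" for x
    by (metis abs_mult abs_ge_zero mult_mono order_trans)
  then show ?thesis
    by (auto simp: bounded_iff)
qed

lemma bounded_range_plus:
  fixes f g :: scalar_fun
  assumes "bounded (range f)" "bounded (range g)"
  shows "bounded (range (\<lambda>x. f x + g x))"
proof -
  obtain a b where "\<And>x. \<bar>f x\<bar> \<le> a" "\<And>x. \<bar>g x\<bar> \<le> b"
    using assms by (auto simp: bounded_iff)
  then have "\<bar>f x + g x\<bar> \<le> a + b" for x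
    by (meson abs_triangle_ineq add_mono order_trans)
  then show ?thesis
    by (auto simp: bounded_iff)
qed

text \<open>
  By the product rule the derivatives of a product are not products but finite sums of products;
  these predicates are closed under differentiation.
\<close>

inductive bounded_smooth_sum :: "scalar_fun \<Rightarrow> bool" where
  base: "bounded_smooth f \<Longrightarrow> bounded_smooth_sum f"
| add: "bounded_smooth_sum f \<Longrightarrow> bounded_smooth_sum g \<Longrightarrow> bounded_smooth_sum (f + g)"
| mult: "bounded_smooth f \<Longrightarrow> bounded_smooth g \<Longrightarrow> bounded_smooth_sum (f * g)"

inductive schwartz_sum :: "scalar_fun \<Rightarrow> bool" where
  mult: "schwartz f \<Longrightarrow> bounded_smooth g \<Longrightarrow> schwartz_sum (f * g)"
| add: "schwartz_sum f \<Longrightarrow> schwartz_sum g \<Longrightarrow> schwartz_sum (f + g)"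

lemma bounded_smooth_sumD:
  assumes "bounded_smooth_sum f"
  shows "f differentiable_on UNIV \<and> bounded (range f) \<and> bounded_smooth_sum (deriv f)"
  using assms
proof induction
  case (base f)
  then show ?case
    by (simp add: bounded_smooth_differentiable bounded_smooth_bounded bounded_smooth_deriv
        bounded_smooth_sum.base)
next
  case (add f g)
  then show ?case
    using bounded_range_plus[of f g] deriv_add_differentiable[of f g]
      differentiable_fun_ops(1)[of f g] bounded_smooth_sum.add[of "deriv f" "deriv g"]
    by (simp only: plus_fun_def[of f g, symmetric] simp_thms)
next
  case (mult f g)
  then have "bounded_smooth_sum (deriv f * g + f * deriv g)"
    by (intro bounded_smooth_sum.add bounded_smooth_sum.mult bounded_smooth_deriv)
  with mult show ?case
    using bounded_range_times[of f g] deriv_fun_mult[of f g] differentiable_fun_ops(2)[of f g]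
    by (simp only: times_fun_def[of f g, symmetric] simp_thms bounded_smooth_bounded
        bounded_smooth_differentiable)
qed

lemma schwartz_sumD:
  assumes "schwartz_sum f"
  shows "f differentiable_on UNIV \<and> (\<forall>k. bounded (range (\<lambda>x. x ^ k * f x)))
    \<and> schwartz_sum (deriv f)"
  using assms
proof induction
  case (mult f g)
  have "bounded (range (\<lambda>x. x ^ k * (f * g) x))" for k
    using bounded_range_times[OF schwartz_decay[OF mult(1)] bounded_smooth_bounded[OF mult(2)], of k]
    by (simp add: mult.assoc)
  moreover have "schwartz_sum (deriv f * g + f * deriv g)"
    using mult by (intro schwartz_sum.intros bounded_smooth_deriv schwartz_deriv)
  ultimately show ?case
    using mult
    by (simp only: deriv_fun_mult schwartz_imp_bounded_smooth
        differentiable_fun_ops bounded_smooth_differentiable simp_thms)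
next
  case (add f g)
  then have "bounded (range (\<lambda>x. x ^ k * (f + g) x))" for k
    using bounded_range_plus[of "\<lambda>x. x ^ k * f x" "\<lambda>x. x ^ k * g x"]
    by (simp add: distrib_left)
  with add show ?case
    by (simp only: deriv_add_differentiable schwartz_sum.add differentiable_fun_ops simp_thms)
qed

lemma bounded_smooth_add: "bounded_smooth f \<Longrightarrow> bounded_smooth g \<Longrightarrow> bounded_smooth (f + g)"
  and bounded_smooth_mult: "bounded_smooth f \<Longrightarrow> bounded_smooth g \<Longrightarrow> bounded_smooth (f * g)"
  by (rule bounded_smooth_coinduct[where P = bounded_smooth_sum];
      auto dest: bounded_smooth_sumD intro: bounded_smooth_sum.intros)+

lemma bounded_smooth_constant: "bounded_smooth (\<lambda>x. c)"
  by (rule bounded_smooth_coinduct[where P = "\<lambda>f. \<exists>c. f = (\<lambda>x. c)"]) auto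

lemma const_eq_times: "const c f = f * (\<lambda>x. c)"
  by (auto simp: const_def)

lemma uminus_eq_times: "- f = f * (\<lambda>x. - 1)" for f :: scalar_fun
  by (auto simp: fun_eq_iff)

lemma bounded_smooth_const: "bounded_smooth f \<Longrightarrow> bounded_smooth (const c f)"
  unfolding const_eq_times by (intro bounded_smooth_mult bounded_smooth_constant)

lemma bounded_smooth_minus: "bounded_smooth f \<Longrightarrow> bounded_smooth (- f)"
  unfolding uminus_eq_times by (intro bounded_smooth_mult bounded_smooth_constant)

lemma bounded_smooth_diff: "bounded_smooth f \<Longrightarrow> bounded_smooth g \<Longrightarrow> bounded_smooth (f - g)"
  unfolding diff_conv_add_uminus by (intro bounded_smooth_add bounded_smooth_minus)

lemma schwartz_mult1: "schwartz f \<Longrightarrow> bounded_smooth g \<Longrightarrow> schwartz (f * g)"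
  by (rule schwartz_coinduct[where P = schwartz_sum])
    (auto dest: schwartz_sumD intro: schwartz_sum.intros)

lemma schwartz_mult2: "bounded_smooth f \<Longrightarrow> schwartz g \<Longrightarrow> schwartz (f * g)"
  by (metis mult.commute schwartz_mult1)

lemma schwartz_add:
  assumes "schwartz f" "schwartz g"
  shows "schwartz (f + g)"
proof -
  \<comment> \<open>The generators of \<open>schwartz_sum\<close> are products, so a single function
    enters as its product with the constant 1.\<close>
  have "schwartz_sum (f * (\<lambda>x. 1) + g * (\<lambda>x. 1))"
    by (intro schwartz_sum.intros assms bounded_smooth_constant)
  then have "schwartz_sum (f + g)"
    by (simp add: times_fun_def)
  then show ?thesis
    by (rule schwartz_coinduct[where P = schwartz_sum])
      (auto dest: schwartz_sumD)
qed

lemma schwartz_const: "schwartz f \<Longrightarrow> schwartz (const c f)"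
  unfolding const_eq_times by (intro schwartz_mult1 bounded_smooth_constant)

lemma schwartz_minus: "schwartz f \<Longrightarrow> schwartz (- f)"
  unfolding uminus_eq_times by (intro schwartz_mult1 bounded_smooth_constant)

lemma schwartz_diff: "schwartz f \<Longrightarrow> schwartz g \<Longrightarrow> schwartz (f - g)"
  unfolding diff_conv_add_uminus by (intro schwartz_add schwartz_minus)

lemma bounded_smooth_isCont: "bounded_smooth f \<Longrightarrow> isCont f x"
  using bounded_smooth_DERIV DERIV_isCont by blast

section \<open>Integrability and decay at infinity\<close>

lemma schwartz_integrable:
  assumes "schwartz f"
  shows "integrable lborel f"
proof -
  obtain a where a: "\<And>x. \<bar>f x\<bar> \<le> a"
    using schwartz_decay[OF assms, of 0] by (auto simp: bounded_iff)
  \<comment> \<open>The exponents 0 and 2 together bound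
    \<open>(1 + x\<^sup>2) * \<bar>f x\<bar>\<close>, which gives an integrable majorant.\<close>
  obtain b where b: "\<And>x. \<bar>x ^ 2 * f x\<bar> \<le> b"
    using schwartz_decay[OF assms, of 2] by (auto simp: bounded_iff)
  have dominating: "integrable lborel (\<lambda>x::real. (a + b) * inverse (1 + x\<^sup>2))"
    using integrable_inverse_1_plus_square by (simp add: set_integrable_def)
  have measurable: "f \<in> borel_measurable lborel"
    using bounded_smooth_isCont[OF schwartz_imp_bounded_smooth[OF assms]]
    by (simp add: borel_measurable_continuous_onI continuous_at_imp_continuous_on)
  have "\<bar>f x\<bar> \<le> (a + b) * inverse (1 + x\<^sup>2)" for x
  proof -
    have "(1 + x\<^sup>2) * \<bar>f x\<bar> \<le> a + b"
      using a[of x] b[of x] by (simp add: abs_mult distrib_right)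
    then show ?thesis
      by (simp add: divide_inverse[symmetric] pos_le_divide_eq mult.commute add_pos_nonneg)
  qed
  then have "AE x in lborel. norm (f x) \<le> norm ((a + b) * inverse (1 + x\<^sup>2))"
    by (intro AE_I2) (metis abs_ge_self order_trans real_norm_def)
  with dominating measurable show ?thesis
    by (rule Bochner_Integration.integrable_bound)
qed

lemma schwartz_tendsto_0:
  assumes "schwartz f"
  shows "(f \<longlongrightarrow> 0) at_top" "(f \<longlongrightarrow> 0) at_bot"
proof -
  obtain b where b: "\<And>x. \<bar>x * f x\<bar> \<le> b"
    using schwartz_decay[OF assms, of 1] by (auto simp: bounded_iff)
  have bound: "\<bar>f x\<bar> \<le> b / \<bar>x\<bar>" if "x \<noteq> 0" for x
    using b[of x] that by (simp add: abs_mult field_simps)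
  show "(f \<longlongrightarrow> 0) at_top"
  proof (rule Lim_null_comparison)
    show "\<forall>\<^sub>F x in at_top. norm (f x) \<le> b / \<bar>x\<bar>"
      using eventually_gt_at_top[of 0] by eventually_elim (metis bound less_irrefl real_norm_def)
    show "((\<lambda>x. b / \<bar>x\<bar>) \<longlongrightarrow> 0) at_top"
      by (intro tendsto_divide_0[OF tendsto_const] filterlim_at_top_imp_at_infinity filterlim_abs_real)
  qed
  show "(f \<longlongrightarrow> 0) at_bot"
  proof (rule Lim_null_comparison)
    show "\<forall>\<^sub>F x in at_bot. norm (f x) \<le> b / \<bar>x\<bar>"
      using eventually_gt_at_bot[of 0] by eventually_elim (metis bound less_irrefl real_norm_def)
    have "filterlim abs at_top (at_bot :: real filter)"
      by (simp add: filterlim_at_bot_mirror filterlim_abs_real)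
    then show "((\<lambda>x. b / \<bar>x\<bar>) \<longlongrightarrow> 0) at_bot"
      by (intro tendsto_divide_0[OF tendsto_const] filterlim_at_top_imp_at_infinity)
  qed
qed

section \<open>The skew-symmetric antiderivative\<close>

context
  fixes f :: scalar_fun
  assumes f: "integrable lborel f"
begin

private lemma set_integrable_f: "A \<in> sets lborel \<Longrightarrow> set_integrable lborel A f"
  unfolding set_integrable_def using integrable_mult_indicator[OF _ f] by blast

text \<open>The two half-lines overlap in a null set only. What depends on \<open>x\<close> is thus
  a single integral with variable upper end, and the rest is a constant.\<close>

lemma Dinv_eq: "Dinv f x = (LBINT t:{..x}. f t) - (LBINT t. f t) / 2"
proof -
  have "(LBINT t:{..x} \<union> {x..}. f t) = (LBINT t:{..x}. f t) + (LBINT t:{x..}. f t)"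
    using AE_lborel_singleton[of x]
    by (intro set_integral_Un_AE set_integrable_f) auto
  moreover have "{..x} \<union> {x..} = UNIV"
    by auto
  ultimately show ?thesis
    by (simp add: Dinv_def set_lebesgue_integral_def field_simps)
qed

lemma Dinv_at_top: "(Dinv f \<longlongrightarrow> (LBINT t. f t) / 2) at_top"
proof -
  have "((\<lambda>x. LBINT t:{..x}. f t) \<longlongrightarrow> (LBINT t. f t)) at_top"
    unfolding set_lebesgue_integral_def by (rule tendsto_integral_at_top) (use f in auto)
  then have "((\<lambda>x. (LBINT t:{..x}. f t) - (LBINT t. f t) / 2)
      \<longlongrightarrow> (LBINT t. f t) - (LBINT t. f t) / 2) at_top"
    by (intro tendsto_intros)
  then show ?thesis
    by (simp add: Dinv_eq[abs_def])
qed

lemma Dinv_at_bot: "(Dinv f \<longlongrightarrow> - (LBINT t. f t) / 2) at_bot"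
proof -
  \<comment> \<open>Reflecting \<open>x\<close> turns the limit at minus infinity into dominated
    convergence along \<open>at_top\<close> with majorant \<open>norm (f t)\<close>.\<close>
  have "((\<lambda>x. LBINT t. indicat_real {..-x} t *\<^sub>R f t) \<longlongrightarrow> integral\<^sup>L lborel (\<lambda>t::real. 0::real)) at_top"
  proof (rule integral_dominated_convergence_at_top[where w = "\<lambda>t. norm (f t)"
        and s = "\<lambda>x t. indicat_real {..-x} t *\<^sub>R f t" and f = "\<lambda>t. 0"])
    show "\<forall>\<^sub>F x in at_top. AE t in lborel. norm (indicat_real {..- x} t *\<^sub>R f t) \<le> norm (f t)"
      by (auto split: split_indicator)
    show "AE t in lborel. ((\<lambda>x. indicat_real {..- x} t *\<^sub>R f t) \<longlongrightarrow> 0) at_top"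
    proof
      fix t :: real
      show "((\<lambda>x. indicat_real {..- x} t *\<^sub>R f t) \<longlongrightarrow> 0) at_top"
        by (intro tendsto_eventually eventually_mono[OF eventually_gt_at_top[of "- t"]]) auto
    qed
  qed (use f in auto)
  then have "((\<lambda>x. LBINT t:{..x}. f t) \<longlongrightarrow> 0) at_bot"
    by (simp add: filterlim_at_bot_mirror set_lebesgue_integral_def)
  then have "((\<lambda>x. (LBINT t:{..x}. f t) - (LBINT t. f t) / 2)
      \<longlongrightarrow> 0 - (LBINT t. f t) / 2) at_bot"
    by (intro tendsto_intros)
  then show ?thesis
    by (simp add: Dinv_eq[abs_def])
qed

lemma Dinv_DERIV:
  assumes "\<And>x. isCont f x"
  shows "(Dinv f has_real_derivative f x) (at x)"
proof -
  \<comment> \<open>Any base point to the left of \<open>x\<close> would do; this one makes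
    \<open>x\<close> an interior point of \<open>{a..x + 1}\<close>, so the one-sided fundamental
    theorem gives a two-sided derivative.\<close>
  define a where "a = x - 1"
  have eq: "Dinv f u = (LBINT t:{..a}. f t) - (LBINT t. f t) / 2 + integral {a..u} f"
    if "u > a" for u
  proof -
    have "(LBINT t:{..a} \<union> {a..u}. f t) = (LBINT t:{..a}. f t) + (LBINT t:{a..u}. f t)"
      using AE_lborel_singleton[of a]
      by (intro set_integral_Un_AE set_integrable_f) auto
    moreover have "{..a} \<union> {a..u} = {..u}"
      using that by auto
    ultimately show ?thesis
      by (simp add: Dinv_eq set_borel_integral_eq_integral set_integrable_f)
  qed
  have "((\<lambda>u. integral {a..u} f) has_real_derivative f x) (at x within {a..x + 1})"
    by (rule integral_has_real_derivative)
      (auto simp: a_def assms continuous_at_imp_continuous_on)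
  then have "((\<lambda>u. integral {a..u} f) has_real_derivative f x) (at x)"
    by (simp add: at_within_Icc_at a_def)
  then have "((\<lambda>u. (LBINT t:{..a}. f t) - (LBINT t. f t) / 2 + integral {a..u} f)
      has_real_derivative f x) (at x)"
    by (auto intro!: derivative_eq_intros)
  then show ?thesis
    by (rule has_field_derivative_transform_within_open[where S = "{a<..}"])
      (auto simp: eq a_def)
qed

end

section \<open>Linearity and smoothness of the antiderivative\<close>

lemma Dinv_add:
  assumes "schwartz f" "schwartz g"
  shows "Dinv (f + g) = Dinv f + Dinv g"
  using assms[THEN schwartz_integrable] integrable_mult_indicator[of _ lborel f]
    integrable_mult_indicator[of _ lborel g]
  by (simp add: Dinv_def fun_eq_iff set_lebesgue_integral_def field_simps)

lemma Dinv_const: "Dinv (const c f) = const c (Dinv f)"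
  by (simp add: Dinv_def const_def fun_eq_iff set_lebesgue_integral_def right_diff_distrib
      mult.left_commute[of _ c])

lemma Dinv_minus: "Dinv (- f) = - Dinv f"
  using Dinv_const[of "- 1" f] by (simp add: const_def fun_Compl_def)

lemma Dinv_diff:
  assumes "schwartz f" "schwartz g"
  shows "Dinv (f - g) = Dinv f - Dinv g"
  using Dinv_add[OF assms(1) schwartz_minus[OF assms(2)]]
  by (simp only: diff_conv_add_uminus Dinv_minus)

lemma deriv_Dinv:
  assumes "schwartz f"
  shows "deriv (Dinv f) = f"
  using assms
  by (auto intro!: DERIV_imp_deriv Dinv_DERIV schwartz_integrable bounded_smooth_isCont
      schwartz_imp_bounded_smooth)

lemma Dinv_bounded:
  assumes "integrable lborel f"
  shows "bounded (range (Dinv f))"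
proof -
  have "\<bar>Dinv f x\<bar> \<le> (LBINT t. \<bar>f t\<bar>) + \<bar>(LBINT t. f t) / 2\<bar>" for x
  proof -
    have "\<bar>LBINT t:{..x}. f t\<bar> \<le> (LBINT t:{..x}. \<bar>f t\<bar>)"
      using integrable_mult_indicator[OF _ assms, of "{..x}"]
      by (simp add: set_lebesgue_integral_def integral_abs_bound[THEN order_trans] abs_mult)
    also have "\<dots> \<le> (LBINT t. \<bar>f t\<bar>)"
      unfolding set_lebesgue_integral_def
      using integrable_mult_indicator[OF _ integrable_abs[OF assms], of "{..x}"] assms
      by (intro integral_mono) (auto split: split_indicator)
    finally show ?thesis
      unfolding Dinv_eq[OF assms] by linarith
  qed
  then show ?thesis
    by (auto simp: bounded_iff)
qed

text \<open>Only the derivative of order zero is nonlocal: one differentiation leads back to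
  \<open>f\<close>. Hence the invariant "equal to \<open>Dinv f\<close> or already bounded
  smooth".\<close>

lemma bounded_smooth_Dinv:
  assumes "schwartz f"
  shows "bounded_smooth (Dinv f)"
proof (rule bounded_smooth_coinduct[where P = "\<lambda>g. g = Dinv f \<or> bounded_smooth g"])
  have "\<And>x. (Dinv f has_real_derivative f x) (at x)"
    using assms by (auto intro!: Dinv_DERIV schwartz_integrable bounded_smooth_isCont
      schwartz_imp_bounded_smooth)
  then have "Dinv f differentiable_on UNIV"
    by (auto simp: differentiable_on_def real_differentiable_def)
  then show "g differentiable_on UNIV" if "g = Dinv f \<or> bounded_smooth g" for g
    using that bounded_smooth_differentiable by blast
  show "bounded (range g)" if "g = Dinv f \<or> bounded_smooth g" for g
    using that bounded_smooth_bounded Dinv_bounded[OF schwartz_integrable[OF assms]] by blast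
  show "deriv g = Dinv f \<or> bounded_smooth (deriv g)" if "g = Dinv f \<or> bounded_smooth g" for g
    using that deriv_Dinv[OF assms] schwartz_imp_bounded_smooth[OF assms] bounded_smooth_deriv
    by auto
qed auto

section \<open>Integrals of total derivatives\<close>

lemma Dinv_deriv_plus_constant:
  assumes F: "bounded_smooth F" and F': "schwartz (deriv F)"
  obtains c where "\<And>x. Dinv (deriv F) x = F x + c"
proof -
  have "((\<lambda>x. Dinv (deriv F) x - F x) has_real_derivative 0) (at x)" for x
    using DERIV_diff[OF bounded_smooth_DERIV[OF bounded_smooth_Dinv[OF F']] bounded_smooth_DERIV[OF F]]
    by (simp add: deriv_Dinv F')
  then have "Dinv (deriv F) x - F x = Dinv (deriv F) 0 - F 0" for x
    using DERIV_isconst_all by blast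
  then have "Dinv (deriv F) x = F x + (Dinv (deriv F) 0 - F 0)" for x
    by (metis add.commute diff_add_cancel)
  then show ?thesis
    using that by blast
qed

text \<open>
  The two limits of \<open>Dinv p\<close> are opposite, so an antiderivative with equal limits at both ends
  forces the integral, and hence also the additive constant, to vanish.
\<close>

lemma integral_deriv_eq_0:
  assumes F: "bounded_smooth F" and F': "schwartz (deriv F)"
    and lim: "(F \<longlongrightarrow> A) at_top" "(F \<longlongrightarrow> A) at_bot"
  shows "(LBINT x. deriv F x) = 0"
proof -
  obtain c where c: "\<And>x. Dinv (deriv F) x = F x + c"
    using Dinv_deriv_plus_constant[OF F F'] by blast
  have "((\<lambda>x. F x + c) \<longlongrightarrow> A + c) at_top" "((\<lambda>x. F x + c) \<longlongrightarrow> A + c) at_bot"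
    by (intro tendsto_intros lim)+
  then have "(LBINT x. deriv F x) / 2 = A + c" "- (LBINT x. deriv F x) / 2 = A + c"
    using Dinv_at_top[OF schwartz_integrable[OF F']] Dinv_at_bot[OF schwartz_integrable[OF F']]
    unfolding c[abs_def]
    by (metis tendsto_unique trivial_limit_at_top_linorder trivial_limit_at_bot_linorder)+
  then show ?thesis
    by simp
qed

text \<open>The constant is found at \<open>at_top\<close>: \<open>F\<close> vanishes there, and so
  does \<open>Dinv (deriv F)\<close>, whose limit is half of an integral equal to zero.\<close>

lemma Dinv_deriv:
  assumes F: "schwartz F"
  shows "Dinv (deriv F) = F"
proof -
  obtain c where c: "\<And>x. Dinv (deriv F) x = F x + c"
    using Dinv_deriv_plus_constant schwartz_imp_bounded_smooth schwartz_deriv F by metis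
  have "((\<lambda>x. F x + c) \<longlongrightarrow> 0 + c) at_top"
    by (intro tendsto_intros schwartz_tendsto_0 F)
  moreover have "((\<lambda>x. F x + c) \<longlongrightarrow> 0) at_top"
    using Dinv_at_top[OF schwartz_integrable[OF schwartz_deriv[OF F]]]
      integral_deriv_eq_0[OF schwartz_imp_bounded_smooth[OF F] schwartz_deriv[OF F]
        schwartz_tendsto_0[OF F]]
    by (simp add: c[abs_def])
  ultimately have "c = 0"
    using tendsto_unique[OF trivial_limit_at_top_linorder] by fastforce
  then show ?thesis
    using c by auto
qed

definition equal_limits :: "scalar_fun \<Rightarrow> bool" where
  "equal_limits F \<longleftrightarrow> (\<exists>A. (F \<longlongrightarrow> A) at_top \<and> (F \<longlongrightarrow> A) at_bot)"

lemma equal_limits_schwartz: "schwartz F \<Longrightarrow> equal_limits F"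
  unfolding equal_limits_def using schwartz_tendsto_0 by blast

lemma equal_limits_add: "equal_limits F \<Longrightarrow> equal_limits G \<Longrightarrow> equal_limits (F + G)"
  unfolding equal_limits_def plus_fun_def by (blast intro: tendsto_add)

lemma equal_limits_const: "equal_limits F \<Longrightarrow> equal_limits (const c F)"
  unfolding equal_limits_def const_def by (blast intro: tendsto_mult_left)

text \<open>The limits of each factor at the two ends are opposite, and the two signs cancel in the
  product.\<close>

lemma equal_limits_Dinv_times_Dinv:
  assumes "schwartz f" "schwartz g"
  shows "equal_limits (Dinv f * Dinv g)"
  unfolding equal_limits_def times_fun_def
  using tendsto_mult[OF assms[THEN schwartz_integrable, THEN Dinv_at_top]]
    tendsto_mult[OF assms[THEN schwartz_integrable, THEN Dinv_at_bot]]
  by auto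

lemma has_bochner_integral_deriv:
  assumes "bounded_smooth F" "schwartz (deriv F)" "equal_limits F"
  shows "has_bochner_integral lborel (deriv F) 0"
  using assms integral_deriv_eq_0[OF assms(1,2)] schwartz_integrable[OF assms(2)]
  by (auto simp: equal_limits_def has_bochner_integral_iff)

lemmas schwartz_intros =
  schwartz_add schwartz_diff schwartz_minus schwartz_const schwartz_deriv schwartz_mult1
  schwartz_mult2
lemmas bounded_smooth_intros =
  bounded_smooth_add bounded_smooth_diff bounded_smooth_minus bounded_smooth_const
  bounded_smooth_deriv bounded_smooth_mult bounded_smooth_Dinv schwartz_imp_bounded_smooth
lemmas smooth_simps = schwartz_intros bounded_smooth_intros
lemmas deriv_simps =
  deriv_fun_add deriv_fun_diff deriv_fun_const deriv_fun_mult deriv_Dinv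

section \<open>Vector functions and Gateaux derivatives\<close>

text \<open>Normal form for the elements of \<open>S2\<close>: with it every identity between vector
  functions splits into two identities between scalar functions.\<close>

definition vfun :: "scalar_fun \<Rightarrow> scalar_fun \<Rightarrow> vector_fun" where
  "vfun f g = (\<lambda>x. (f x, g x))"

lemma vfun_in_S2 [simp]: "vfun f g \<in> S2 \<longleftrightarrow> schwartz f \<and> schwartz g"
  by (simp add: S2_def vfun_def)

lemma S2_E:
  assumes "X \<in> S2"
  obtains f g where "X = vfun f g" "schwartz f" "schwartz g"
  using assms that[of "\<lambda>x. fst (X x)" "\<lambda>x. snd (X x)"] by (simp add: S2_def vfun_def)

lemma vfun_add: "vfun f g + vfun h k = vfun (f + h) (g + k)"
  and vfun_diff: "vfun f g - vfun h k = vfun (f - h) (g - k)"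
  and vscale_vfun: "vscale c (vfun f g) = vfun (const c f) (const c g)"
  and vfun_eq_iff: "vfun f g = vfun h k \<longleftrightarrow> f = h \<and> g = k"
  by (auto simp: vfun_def vscale_def const_def fun_eq_iff)

lemma pairing_vfun: "pairing (vfun f g) (vfun h k) = (LBINT x. (f * h + g * k) x)"
  by (simp add: pairing_def vfun_def inner_prod_def)

text \<open>In \<open>M\<close> and in \<open>Phi\<close> each nonlocal term contains the potential
  exactly twice and the local terms do not contain it. Along a line both are polynomials of degree
  two in \<epsilon>, so the Gateaux derivative is read off as the linear coefficient and no limit
  has to be taken under an integral.\<close>

lemma gateaux_quadratic_DERIV:
  assumes "\<And>\<epsilon>. A (u + vscale \<epsilon> W) Y = P + vscale \<epsilon> B + vscale (\<epsilon>\<^sup>2) C"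
  shows "((\<lambda>\<epsilon>. A (u + vscale \<epsilon> W) Y x) has_vector_derivative B x) (at 0)"
proof -
  have "((\<lambda>\<epsilon>. P x + \<epsilon> *\<^sub>R B x + \<epsilon>\<^sup>2 *\<^sub>R C x) has_vector_derivative B x) (at 0)"
    by (auto intro!: derivative_eq_intros)
  moreover have "A (u + vscale \<epsilon> W) Y x = P x + \<epsilon> *\<^sub>R B x + \<epsilon>\<^sup>2 *\<^sub>R C x" for \<epsilon>
    unfolding assms by (simp add: vscale_def)
  ultimately show ?thesis
    by (simp only:)
qed

lemma gateaux_quadratic:
  assumes "\<And>\<epsilon>. A (u + vscale \<epsilon> W) Y = P + vscale \<epsilon> B + vscale (\<epsilon>\<^sup>2) C"
  shows "gateaux A u W Y = B"
  unfolding gateaux_def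
  by (intro ext vector_derivative_at gateaux_quadratic_DERIV[OF assms])

lemma gateaux_differentiable_quadratic:
  assumes "\<And>u W Y. u \<in> S2 \<Longrightarrow> W \<in> S2 \<Longrightarrow> Y \<in> S2 \<Longrightarrow> \<exists>P B C. B \<in> S2 \<and>
    (\<forall>\<epsilon>. A (u + vscale \<epsilon> W) Y = P + vscale \<epsilon> B + vscale (\<epsilon>\<^sup>2) C)"
  shows "gateaux_differentiable A"
  unfolding gateaux_differentiable_def
proof (intro ballI)
  fix u W Y assume "u \<in> S2" "W \<in> S2" "Y \<in> S2"
  then obtain P B C where *: "B \<in> S2"
      "\<And>\<epsilon>. A (u + vscale \<epsilon> W) Y = P + vscale \<epsilon> B + vscale (\<epsilon>\<^sup>2) C"
    using assms by meson
  then show "(\<forall>x. (\<lambda>\<epsilon>. A (u + vscale \<epsilon> W) Y x) differentiable at 0) \<and> gateaux A u W Y \<in> S2"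
    using gateaux_quadratic_DERIV[OF *(2)] gateaux_quadratic[of A, OF *(2)] differentiableI_vector
    by metis
qed

section \<open>The operator \<open>M\<close>\<close>

lemma M_op_vfun_eq:
  "M_op a b c (vfun q r) (vfun f g) =
     vfun (const a (q * Dinv (q * f)) + (const b g + const c (deriv g) - const a (q * Dinv (r * g))))
       (const (- b) f + const c (deriv f) - const a (r * Dinv (q * f)) + const a (r * Dinv (r * g)))"
  by (simp add: M_op_def vfun_def matrix_op_def Let_def mult_def times_fun_def const_def fun_diff_def
      plus_fun_def)

text \<open>Additivity of \<open>Dinv\<close> merges the four nonlocal entries into one scalar
  antiderivative, that of v . X.\<close>

lemma M_op_vfun:
  assumes "schwartz q" "schwartz r" "schwartz f" "schwartz g"
  shows "M_op a b c (vfun q r) (vfun f g) =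
     vfun (const a (q * Dinv (q * f - r * g)) + const b g + const c (deriv g))
       (const c (deriv f) - const b f - const a (r * Dinv (q * f - r * g)))"
  using assms
  by (simp add: M_op_vfun_eq vfun_eq_iff Dinv_diff smooth_simps)
    (simp add: const_def fun_eq_iff algebra_simps)

lemma M_op_S2: "u \<in> S2 \<Longrightarrow> X \<in> S2 \<Longrightarrow> M_op a b c u X \<in> S2"
  by (auto elim!: S2_E simp: M_op_vfun smooth_simps)

lemma Dinv_combination:
  assumes "schwartz f" "schwartz g"
  shows "Dinv (const a f + const b g) = const a (Dinv f) + const b (Dinv g)"
  using assms by (simp add: Dinv_add Dinv_const smooth_simps)

lemma linear_op_M: "linear_op (M_op a b c)"
  unfolding linear_op_def
proof (intro conjI ballI allI)
  fix u X Y s t assume "u \<in> S2" "X \<in> S2" "Y \<in> S2"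
  then obtain q r f g h k where eqs: "u = vfun q r" "X = vfun f g" "Y = vfun h k"
    and S: "schwartz q" "schwartz r" "schwartz f" "schwartz g" "schwartz h" "schwartz k"
    by (metis S2_E)
  have arg: "q * (const s f + const t h) - r * (const s g + const t k)
      = const s (q * f - r * g) + const t (q * h - r * k)"
    by (auto simp: const_def fun_eq_iff algebra_simps)
  show "M_op a b c u (vscale s X + vscale t Y) =
      vscale s (M_op a b c u X) + vscale t (M_op a b c u Y)"
    using S
    by (simp add: eqs vfun_add vscale_vfun M_op_vfun smooth_simps arg Dinv_combination deriv_simps
        vfun_eq_iff)
      (simp add: const_def fun_eq_iff algebra_simps)
qed (simp add: M_op_S2)

lemma M_op_perturbed:
  assumes S: "schwartz q" "schwartz r" "schwartz w1" "schwartz w2" "schwartz f" "schwartz g"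
  shows "M_op a b c (vfun q r + vscale \<epsilon> (vfun w1 w2)) (vfun f g) =
    M_op a b c (vfun q r) (vfun f g)
    + vscale \<epsilon> (vfun (const a (w1 * Dinv (q * f - r * g) + q * Dinv (w1 * f - w2 * g)))
        (const (- a) (w2 * Dinv (q * f - r * g) + r * Dinv (w1 * f - w2 * g))))
    + vscale (\<epsilon>\<^sup>2) (vfun (const a (w1 * Dinv (w1 * f - w2 * g)))
        (const (- a) (w2 * Dinv (w1 * f - w2 * g))))"
proof -
  \<comment> \<open>The factor \<open>const 1\<close> gives the first summand the shape required by
    \<open>Dinv_combination\<close>.\<close>
  have arg: "(q + const \<epsilon> w1) * f - (r + const \<epsilon> w2) * g
      = const 1 (q * f - r * g) + const \<epsilon> (w1 * f - w2 * g)"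
    by (auto simp: const_def fun_eq_iff algebra_simps)
  show ?thesis
    using S
    by (simp add: vfun_add vscale_vfun M_op_vfun smooth_simps arg Dinv_combination vfun_eq_iff)
      (simp add: const_def fun_eq_iff algebra_simps power2_eq_square)
qed

text \<open>The local part is independent of the potential; what remains is the product rule for v
  Dinv v^T.\<close>

lemma gateaux_M:
  assumes "schwartz q" "schwartz r" "schwartz w1" "schwartz w2" "schwartz f" "schwartz g"
  shows "gateaux (M_op a b c) (vfun q r) (vfun w1 w2) (vfun f g) =
    vfun (const a (w1 * Dinv (q * f - r * g) + q * Dinv (w1 * f - w2 * g)))
      (const (- a) (w2 * Dinv (q * f - r * g) + r * Dinv (w1 * f - w2 * g)))"
  by (rule gateaux_quadratic) (rule M_op_perturbed[OF assms])

lemma gateaux_differentiable_M: "gateaux_differentiable (M_op a b c)"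
proof (rule gateaux_differentiable_quadratic)
  fix u W Y assume "u \<in> S2" "W \<in> S2" "Y \<in> S2"
  then obtain q r w1 w2 f g where eqs: "u = vfun q r" "W = vfun w1 w2" "Y = vfun f g"
    and S: "schwartz q" "schwartz r" "schwartz w1" "schwartz w2" "schwartz f" "schwartz g"
    by (metis S2_E)
  show "\<exists>P B C. B \<in> S2 \<and>
    (\<forall>\<epsilon>. M_op a b c (u + vscale \<epsilon> W) Y = P + vscale \<epsilon> B + vscale (\<epsilon>\<^sup>2) C)"
    unfolding eqs
    by (rule exI, rule exI, rule exI, rule conjI[OF _ allI], rule_tac [2] M_op_perturbed)
      (use S in \<open>simp_all add: smooth_simps\<close>)
qed

section \<open>Skew symmetry and the Jacobi identity\<close>

lemma skew_symmetric_M: "skew_symmetric (M_op a b c)"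
  unfolding skew_symmetric_def
proof (intro ballI)
  fix u X Y assume "u \<in> S2" "X \<in> S2" "Y \<in> S2"
  then obtain q r f g h k where eqs: "u = vfun q r" "X = vfun f g" "Y = vfun h k"
    and S: "schwartz q" "schwartz r" "schwartz f" "schwartz g" "schwartz h" "schwartz k"
    by (metis S2_E)
  obtain m1 m2 n1 n2 where M: "M_op a b c u X = vfun m1 m2" "M_op a b c u Y = vfun n1 n2"
    and SM: "schwartz m1" "schwartz m2" "schwartz n1" "schwartz n2"
    using S M_op_S2[of u X a b c] M_op_S2[of u Y a b c] by (metis S2_E eqs vfun_in_S2)
  define p1 p2 where "p1 = q * f - r * g" and "p2 = q * h - r * k"
  define D1 D2 where "D1 = Dinv p1" and "D2 = Dinv p2"
  have Sp: "schwartz p1" "schwartz p2"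
    using S by (simp_all add: p1_def p2_def smooth_simps)
  then have D: "bounded_smooth D1" "bounded_smooth D2" "deriv D1 = p1" "deriv D2 = p2"
    by (simp_all add: D1_def D2_def bounded_smooth_Dinv deriv_Dinv)
  \<comment> \<open>An antiderivative of the sum of both integrands: the nonlocal terms give
    \<open>p1 * D2 + D1 * p2\<close>, the terms with \<open>b\<close> cancel pointwise, and those
    with \<open>c\<close> are a product rule.\<close>
  define F where "F = const a (D1 * D2) + const c (g * h + f * k)"
  have m_eq: "m1 = const a (q * D1) + const b g + const c (deriv g)"
    "m2 = const c (deriv f) - const b f - const a (r * D1)"
    "n1 = const a (q * D2) + const b k + const c (deriv k)"
    "n2 = const c (deriv h) - const b h - const a (r * D2)"
    using M S unfolding eqs by (simp_all add: M_op_vfun vfun_eq_iff D1_def D2_def p1_def p2_def)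
  have "deriv F = const a (p1 * D2 + D1 * p2)
      + const c ((deriv g * h + g * deriv h) + (deriv f * k + f * deriv k))"
    using S D by (simp add: F_def deriv_simps smooth_simps)
  also have "\<dots> = (m1 * h + m2 * k) + (f * n1 + g * n2)"
    by (simp add: m_eq p1_def p2_def const_def fun_eq_iff algebra_simps)
  finally have F': "deriv F = (m1 * h + m2 * k) + (f * n1 + g * n2)" .
  have "has_bochner_integral lborel (deriv F) 0"
  proof (rule has_bochner_integral_deriv)
    show "bounded_smooth F"
      using S D by (simp add: F_def smooth_simps)
    show "schwartz (deriv F)"
      unfolding F' using S SM by (simp add: smooth_simps)
    show "equal_limits F"
      unfolding F_def D1_def D2_def using S Sp
      by (intro equal_limits_add equal_limits_const equal_limits_Dinv_times_Dinv
          equal_limits_schwartz) (simp_all add: smooth_simps)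
  qed
  moreover have "integrable lborel (m1 * h + m2 * k)" "integrable lborel (f * n1 + g * n2)"
    using S SM by (auto intro!: schwartz_integrable simp: smooth_simps)
  ultimately show "pairing (M_op a b c u X) Y = - pairing X (M_op a b c u Y)"
    unfolding M unfolding eqs pairing_vfun F'
    by (simp add: has_bochner_integral_iff plus_fun_def)
qed

text \<open>
  For \<open>v = (q, - r)\<close> and \<open>w\<^sub>X = (M\<^sub>1 X, - M\<^sub>2 X)\<close>, integration by parts moves every
  \<open>Dinv\<close> from \<open>w\<^sub>X \<bullet> Y\<close> to \<open>v \<bullet> Z\<close>; after this only a total derivative remains.  The
  antiderivative \<open>F\<close> collects the boundary terms.
\<close>

lemma jacobi_identity_M: "jacobi_identity (M_op a b c)"
  unfolding jacobi_identity_def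
proof (intro ballI)
  fix u X Y Z assume "u \<in> S2" "X \<in> S2" "Y \<in> S2" "Z \<in> S2"
  then obtain q r f g h k l m
    where eqs: "u = vfun q r" "X = vfun f g" "Y = vfun h k" "Z = vfun l m"
    and S: "schwartz q" "schwartz r" "schwartz f" "schwartz g" "schwartz h" "schwartz k"
      "schwartz l" "schwartz m"
    by (metis S2_E)
  obtain x1 x2 y1 y2 z1 z2
    where M: "M_op a b c u X = vfun x1 x2" "M_op a b c u Y = vfun y1 y2" "M_op a b c u Z = vfun z1 z2"
    and SM: "schwartz x1" "schwartz x2" "schwartz y1" "schwartz y2" "schwartz z1" "schwartz z2"
    using S M_op_S2[of u X a b c] M_op_S2[of u Y a b c] M_op_S2[of u Z a b c]
    by (metis S2_E eqs vfun_in_S2)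
  define pX pY pZ where "pX = q * f - r * g" and "pY = q * h - r * k" and "pZ = q * l - r * m"
  define eX eY eZ where "eX = x1 * h - x2 * k" and "eY = y1 * l - y2 * m"
    and "eZ = z1 * f - z2 * g"
  define DX DY DZ where "DX = Dinv pX" and "DY = Dinv pY" and "DZ = Dinv pZ"
  define KX KY KZ where "KX = Dinv eX" and "KY = Dinv eY" and "KZ = Dinv eZ"
  have Sp: "schwartz pX" "schwartz pY" "schwartz pZ" "schwartz eX" "schwartz eY" "schwartz eZ"
    using S SM by (simp_all add: pX_def pY_def pZ_def eX_def eY_def eZ_def smooth_simps)
  then have D: "bounded_smooth DX" "bounded_smooth DY" "bounded_smooth DZ"
    "bounded_smooth KX" "bounded_smooth KY" "bounded_smooth KZ"
    "deriv DX = pX" "deriv DY = pY" "deriv DZ = pZ"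
    "deriv KX = eX" "deriv KY = eY" "deriv KZ = eZ"
    by (simp_all add: DX_def DY_def DZ_def KX_def KY_def KZ_def bounded_smooth_Dinv deriv_Dinv)
  have M_eq:
    "x1 = const a (q * DX) + const b g + const c (deriv g)"
    "x2 = const c (deriv f) - const b f - const a (r * DX)"
    "y1 = const a (q * DY) + const b k + const c (deriv k)"
    "y2 = const c (deriv h) - const b h - const a (r * DY)"
    "z1 = const a (q * DZ) + const b m + const c (deriv m)"
    "z2 = const c (deriv l) - const b l - const a (r * DZ)"
    using M S unfolding eqs
    by (simp_all add: M_op_vfun vfun_eq_iff DX_def DY_def DZ_def pX_def pY_def pZ_def)
  have gateaux:
    "gateaux (M_op a b c) u (M_op a b c u X) Y
       = vfun (const a (x1 * DY + q * KX)) (const (- a) (x2 * DY + r * KX))"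
    "gateaux (M_op a b c) u (M_op a b c u Y) Z
       = vfun (const a (y1 * DZ + q * KY)) (const (- a) (y2 * DZ + r * KY))"
    "gateaux (M_op a b c) u (M_op a b c u Z) X
       = vfun (const a (z1 * DX + q * KZ)) (const (- a) (z2 * DX + r * KZ))"
    unfolding M unfolding eqs using S SM
    by (simp_all add: gateaux_M DX_def DY_def DZ_def pX_def pY_def pZ_def
        KX_def KY_def KZ_def eX_def eY_def eZ_def)
  \<comment> \<open>The first three products account for all terms with \<open>a\<close> and
    \<open>b\<close> inside the brackets. The terms with \<open>c\<close> then differ by
    \<open>DX * deriv (h * m - k * l)\<close> and its cyclic images, whence the last line of
    \<open>F\<close>. The extra terms \<open>pX * (h * m - k * l)\<close> and so on created by the
    product rule add up to zero: this is the relation X (Y ^ Z) + Y (Z ^ X) + Z (X ^ Y) = 0 of three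
    plane vectors, paired with v.\<close>
  define F where "F = const a (DZ * KX + DX * KY + DY * KZ
    + const c (DX * (h * m - k * l) + DY * (l * g - m * f) + DZ * (f * k - g * h)))"
  define I where "I = l * const a (x1 * DY + q * KX) + m * const (- a) (x2 * DY + r * KX)
    + (f * const a (y1 * DZ + q * KY) + g * const (- a) (y2 * DZ + r * KY))
    + (h * const a (z1 * DX + q * KZ) + k * const (- a) (z2 * DX + r * KZ))"
  have "deriv F = const a ((pZ * KX + DZ * eX) + (pX * KY + DX * eY) + (pY * KZ + DY * eZ)
    + const c
      ((pX * (h * m - k * l)
        + DX * (deriv h * m + h * deriv m - (deriv k * l + k * deriv l)))
      + (pY * (l * g - m * f)
        + DY * (deriv l * g + l * deriv g - (deriv m * f + m * deriv f)))
      + (pZ * (f * k - g * h)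
        + DZ * (deriv f * k + f * deriv k - (deriv g * h + g * deriv h)))))"
    using S D by (simp add: F_def deriv_simps smooth_simps)
  also have "\<dots> = I"
    by (simp add: I_def M_eq pX_def pY_def pZ_def eX_def eY_def eZ_def const_def fun_eq_iff
        algebra_simps)
  finally have F': "deriv F = I" .
  have "has_bochner_integral lborel (deriv F) 0"
  proof (rule has_bochner_integral_deriv)
    show "bounded_smooth F"
      using S D by (simp add: F_def smooth_simps)
    show "schwartz (deriv F)"
      unfolding F' I_def using S SM D by (simp add: smooth_simps)
    show "equal_limits F"
      unfolding F_def DX_def DY_def DZ_def KX_def KY_def KZ_def using S Sp
      by (intro equal_limits_add equal_limits_const equal_limits_Dinv_times_Dinv
          equal_limits_schwartz[of "_ * (_ - _)"]) (simp_all add: smooth_simps)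
  qed
  then show "has_bochner_integral lborel
      (\<lambda>x. Z x \<bullet> gateaux (M_op a b c) u (M_op a b c u X) Y x
         + X x \<bullet> gateaux (M_op a b c) u (M_op a b c u Y) Z x
         + Y x \<bullet> gateaux (M_op a b c) u (M_op a b c u Z) X x) 0"
    unfolding F' gateaux I_def unfolding eqs vfun_def by (simp add: inner_prod_def plus_fun_def)
qed

lemma hamiltonian_M: "hamiltonian (M_op a b c)"
  unfolding hamiltonian_def
  using linear_op_M gateaux_differentiable_M skew_symmetric_M jacobi_identity_M by blast

section \<open>The operator \<open>J\<close> and its inverse\<close>

lemma J_op_eq_M_op: "J_op b1 b2 = M_op b1 b2 0"
  by (simp add: J_op_def M_op_def Let_def fun_eq_iff matrix_op_def const_def)

lemma J_op_S2: "u \<in> S2 \<Longrightarrow> X \<in> S2 \<Longrightarrow> J_op b1 b2 u X \<in> S2"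
  by (simp add: J_op_eq_M_op M_op_S2)

lemma hamiltonian_pair_J_M: "hamiltonian_pair (J_op b1 b2) (M_op a1 a2 a3)"
  unfolding hamiltonian_pair_def
proof (intro allI)
  fix s t
  have "(\<lambda>u X. vscale s (J_op b1 b2 u X) + vscale t (M_op a1 a2 a3 u X))
      = M_op (s * b1 + t * a1) (s * b2 + t * a2) (t * a3)"
    by (simp add: J_op_def M_op_def Let_def fun_eq_iff matrix_op_def const_def vscale_def mult_def
        algebra_simps)
  then show "hamiltonian (\<lambda>u X. vscale s (J_op b1 b2 u X) + vscale t (M_op a1 a2 a3 u X))"
    using hamiltonian_M by simp
qed

lemma J_inv_formula_vfun:
  assumes "schwartz q" "schwartz r" "schwartz f" "schwartz g"
  shows "J_inv_formula b1 b2 (vfun q r) (vfun f g) =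
    vfun (const (1 / b2\<^sup>2) (const b1 (r * Dinv (r * f + q * g)) - const b2 g))
      (const (1 / b2\<^sup>2) (const b1 (q * Dinv (r * f + q * g)) + const b2 f))"
proof -
  have "J_inv_formula b1 b2 (vfun q r) (vfun f g) =
    vfun (const (1 / b2\<^sup>2) (const b1 (r * Dinv (r * f)) + (const (- b2) g + const b1 (r * Dinv (q * g)))))
      (const (1 / b2\<^sup>2) (const b2 f + const b1 (q * Dinv (r * f)) + const b1 (q * Dinv (q * g))))"
    by (simp add: J_inv_formula_def vfun_def matrix_op_def Let_def mult_def times_fun_def const_def
        fun_diff_def plus_fun_def vscale_def)
  then show ?thesis
    using assms
    by (simp add: vfun_eq_iff Dinv_add smooth_simps)
      (simp add: const_def fun_eq_iff algebra_simps)
qed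

lemma J_inv_formula_S2: "u \<in> S2 \<Longrightarrow> X \<in> S2 \<Longrightarrow> J_inv_formula b1 b2 u X \<in> S2"
  by (auto elim!: S2_E simp: J_inv_formula_vfun smooth_simps)

text \<open>The formula is a geometric series that stops. With N = sigma^-1 v Dinv v^T one has J =
  b2 sigma (1 + (b1/b2) N), and N N = 0 because v^T sigma^-1 v = 0. So the inverse is (1 - (b1/b2)
  N) sigma^-1 / b2, where sigma^-1 v = s and v^T sigma^-1 = - s^T.\<close>

lemma J_J_inv:
  assumes "b2 \<noteq> 0" "u \<in> S2" "X \<in> S2"
  shows "J_op b1 b2 u (J_inv_formula b1 b2 u X) = X"
proof -
  obtain q r f g where eqs: "u = vfun q r" "X = vfun f g"
    and S: "schwartz q" "schwartz r" "schwartz f" "schwartz g"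
    using assms(2,3) by (metis S2_E)
  define y where "y = Dinv (r * f + q * g)"
  have y: "bounded_smooth y"
    using S by (simp add: y_def smooth_simps)
  have "q * const (1 / b2\<^sup>2) (const b1 (r * y) - const b2 g)
      - r * const (1 / b2\<^sup>2) (const b1 (q * y) + const b2 f) = const (- 1 / b2) (r * f + q * g)"
    using assms(1) by (auto simp: const_def fun_eq_iff field_simps power2_eq_square)
  then show ?thesis
    using S y assms(1)
    by (simp add: eqs J_op_eq_M_op J_inv_formula_vfun M_op_vfun smooth_simps Dinv_const
        y_def[symmetric] vfun_eq_iff)
      (simp add: const_def fun_eq_iff field_simps power2_eq_square)
qed

text \<open>On an infinite-dimensional space a right inverse does not imply injectivity, so the
  other composition is computed as well; v and s exchange their roles.\<close>

lemma J_inv_J: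
  assumes "b2 \<noteq> 0" "u \<in> S2" "X \<in> S2"
  shows "J_inv_formula b1 b2 u (J_op b1 b2 u X) = X"
proof -
  obtain q r f g where eqs: "u = vfun q r" "X = vfun f g"
    and S: "schwartz q" "schwartz r" "schwartz f" "schwartz g"
    using assms(2,3) by (metis S2_E)
  define y where "y = Dinv (q * f - r * g)"
  have y: "bounded_smooth y"
    using S by (simp add: y_def smooth_simps)
  \<comment> \<open>The summands with \<open>const 0\<close> come from reading \<open>J\<close> as
    \<open>M\<close> without its derivative term.\<close>
  have "r * (const b1 (q * y) + const b2 g + const 0 (deriv g))
      + q * (const 0 (deriv f) - const b2 f - const b1 (r * y)) = const (- b2) (q * f - r * g)"
    by (auto simp: const_def fun_eq_iff algebra_simps)
  then show ?thesis
    using S y assms(1)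
    by (simp add: eqs J_op_eq_M_op J_inv_formula_vfun M_op_vfun smooth_simps Dinv_const
        y_def[symmetric] vfun_eq_iff)
      (simp add: const_def fun_eq_iff field_simps power2_eq_square)
qed

lemma bij_betw_J:
  assumes "b2 \<noteq> 0" "u \<in> S2"
  shows "bij_betw (J_op b1 b2 u) S2 S2"
  by (rule bij_betwI[where g = "J_inv_formula b1 b2 u"])
    (use assms in \<open>auto simp: J_J_inv J_inv_J J_inv_formula_S2 J_op_S2\<close>)

lemma inverse_op_J:
  assumes "b2 \<noteq> 0" "u \<in> S2" "X \<in> S2"
  shows "inverse_op (J_op b1 b2) u X = J_inv_formula b1 b2 u X"
  unfolding inverse_op_def
  using assms bij_betw_J[OF assms(1,2), of b1]
  by (intro inv_into_f_eq) (auto simp: bij_betw_def J_J_inv J_inv_formula_S2)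


section \<open>The hereditary symmetry\<close>

text \<open>Operators with constant coefficients commute; the diagonal entries of k0 + k1 P d and of
  k2 P + k3 d are all of this kind.\<close>

definition first_order_op :: "real \<Rightarrow> real \<Rightarrow> scalar_op" where
  "first_order_op a b f = const a f + const b (deriv f)"

lemma schwartz_first_order_op: "schwartz f \<Longrightarrow> schwartz (first_order_op a b f)"
  by (simp add: first_order_op_def smooth_simps)

lemma first_order_op_add:
  "schwartz f \<Longrightarrow> schwartz g \<Longrightarrow>
    first_order_op a b (f + g) = first_order_op a b f + first_order_op a b g"
  by (simp add: first_order_op_def deriv_simps smooth_simps)
    (simp add: const_def fun_eq_iff algebra_simps)

lemma first_order_op_diff:
  "schwartz f \<Longrightarrow> schwartz g \<Longrightarrow>
    first_order_op a b (f - g) = first_order_op a b f - first_order_op a b g"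
  by (simp add: first_order_op_def deriv_simps smooth_simps)
    (simp add: const_def fun_eq_iff algebra_simps)

lemma first_order_op_const:
  "schwartz f \<Longrightarrow> first_order_op a b (const c f) = const c (first_order_op a b f)"
  by (simp add: first_order_op_def deriv_simps smooth_simps)
    (simp add: const_def fun_eq_iff algebra_simps)

lemma first_order_op_commute:
  "schwartz f \<Longrightarrow> first_order_op a b (first_order_op c d f) = first_order_op c d (first_order_op a b f)"
  by (simp add: first_order_op_def deriv_simps smooth_simps)
    (simp add: const_def fun_eq_iff algebra_simps)

text \<open>Heredity holds whatever the four constants are, so it is proved without reference to
  \<alpha>, \<beta> and division by \<open>\<beta>2\<close>. The matrix P appears as the sign change
  of \<open>k1\<close> and \<open>k2\<close> in the second component.\<close>

locale recursion_operator =
  fixes A :: "vector_fun \<Rightarrow> vector_op" and k0 k1 k2 k3 :: real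
  assumes A_vfun: "schwartz q \<Longrightarrow> schwartz r \<Longrightarrow> schwartz f \<Longrightarrow> schwartz g \<Longrightarrow>
    A (vfun q r) (vfun f g) =
      vfun (first_order_op k0 k1 f + first_order_op k2 k3 (q * Dinv (r * f + q * g)))
        (first_order_op k0 (- k1) g + first_order_op (- k2) k3 (r * Dinv (r * f + q * g)))"
begin

lemma A_S2: "u \<in> S2 \<Longrightarrow> X \<in> S2 \<Longrightarrow> A u X \<in> S2"
  by (auto elim!: S2_E simp: A_vfun smooth_simps schwartz_first_order_op)

lemma linear: "linear_op A"
  unfolding linear_op_def
proof (intro conjI ballI allI)
  fix u X Y s t assume "u \<in> S2" "X \<in> S2" "Y \<in> S2"
  then obtain q r f g h k where eqs: "u = vfun q r" "X = vfun f g" "Y = vfun h k"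
    and S: "schwartz q" "schwartz r" "schwartz f" "schwartz g" "schwartz h" "schwartz k"
    by (metis S2_E)
  have arg: "r * (const s f + const t h) + q * (const s g + const t k)
      = const s (r * f + q * g) + const t (r * h + q * k)"
    by (auto simp: const_def fun_eq_iff algebra_simps)
  have times: "p * (const s (Dinv x) + const t (Dinv y)) = const s (p * Dinv x) + const t (p * Dinv y)"
    for p x y
    by (auto simp: const_def fun_eq_iff algebra_simps)
  show "A u (vscale s X + vscale t Y) = vscale s (A u X) + vscale t (A u Y)"
    using S
    by (simp add: eqs vfun_add vscale_vfun A_vfun smooth_simps arg Dinv_combination times
        first_order_op_add first_order_op_const vfun_eq_iff)
      (simp add: const_def fun_eq_iff algebra_simps)
qed (simp add: A_S2)

lemma perturbed:
  assumes S: "schwartz q" "schwartz r" "schwartz w1" "schwartz w2" "schwartz f" "schwartz g"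
  shows "A (vfun q r + vscale \<epsilon> (vfun w1 w2)) (vfun f g) = A (vfun q r) (vfun f g)
    + vscale \<epsilon> (vfun
        (first_order_op k2 k3 (w1 * Dinv (r * f + q * g) + q * Dinv (w2 * f + w1 * g)))
        (first_order_op (- k2) k3 (w2 * Dinv (r * f + q * g) + r * Dinv (w2 * f + w1 * g))))
    + vscale (\<epsilon>\<^sup>2) (vfun (first_order_op k2 k3 (w1 * Dinv (w2 * f + w1 * g)))
        (first_order_op (- k2) k3 (w2 * Dinv (w2 * f + w1 * g))))"
proof -
  define y z where "y = Dinv (r * f + q * g)" and "z = Dinv (w2 * f + w1 * g)"
  have yz: "bounded_smooth y" "bounded_smooth z"
    using S by (simp_all add: y_def z_def smooth_simps)
  have arg: "(r + const \<epsilon> w2) * f + (q + const \<epsilon> w1) * g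
      = const 1 (r * f + q * g) + const \<epsilon> (w2 * f + w1 * g)"
    by (auto simp: const_def fun_eq_iff algebra_simps)
  have times: "(p + const \<epsilon> w) * (const 1 y + const \<epsilon> z)
      = p * y + const \<epsilon> (w * y + p * z) + const (\<epsilon>\<^sup>2) (w * z)" for p w
    by (auto simp: const_def fun_eq_iff algebra_simps power2_eq_square)
  show ?thesis
    using S yz
    by (simp add: vfun_add vscale_vfun A_vfun smooth_simps arg Dinv_combination times
        first_order_op_add first_order_op_const vfun_eq_iff y_def[symmetric] z_def[symmetric])
qed

lemma gateaux_eq:
  assumes "schwartz q" "schwartz r" "schwartz w1" "schwartz w2" "schwartz f" "schwartz g"
  shows "gateaux A (vfun q r) (vfun w1 w2) (vfun f g) =
    vfun (first_order_op k2 k3 (w1 * Dinv (r * f + q * g) + q * Dinv (w2 * f + w1 * g)))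
      (first_order_op (- k2) k3 (w2 * Dinv (r * f + q * g) + r * Dinv (w2 * f + w1 * g)))"
  by (rule gateaux_quadratic) (rule perturbed[OF assms])

lemma gateaux_differentiable: "gateaux_differentiable A"
proof (rule gateaux_differentiable_quadratic)
  fix u W Y assume "u \<in> S2" "W \<in> S2" "Y \<in> S2"
  then obtain q r w1 w2 f g where eqs: "u = vfun q r" "W = vfun w1 w2" "Y = vfun f g"
    and S: "schwartz q" "schwartz r" "schwartz w1" "schwartz w2" "schwartz f" "schwartz g"
    by (metis S2_E)
  show "\<exists>P B C. B \<in> S2 \<and> (\<forall>\<epsilon>. A (u + vscale \<epsilon> W) Y = P + vscale \<epsilon> B + vscale (\<epsilon>\<^sup>2) C)"
    unfolding eqs
    by (rule exI, rule exI, rule exI, rule conjI[OF _ allI], rule_tac [2] perturbed)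
      (use S in \<open>simp_all add: smooth_simps schwartz_first_order_op\<close>)
qed

text \<open>
  Both sides of the hereditary identity are images under the outer first-order operators, which
  commute with the leading differential part of the operator.  Before applying them, the nonlocal
  terms combine into \<open>Dinv\<close> of the total derivative of \<open>F\<close>.
\<close>

lemma hereditary_identity:
  assumes "u \<in> S2" "X \<in> S2" "Y \<in> S2"
  shows "gateaux A u (A u X) Y - A u (gateaux A u X Y) =
    gateaux A u (A u Y) X - A u (gateaux A u Y X)"
proof -
  obtain q r f g h k where eqs: "u = vfun q r" "X = vfun f g" "Y = vfun h k"
    and S: "schwartz q" "schwartz r" "schwartz f" "schwartz g" "schwartz h" "schwartz k"
    using assms by (metis S2_E)
  obtain a1 a2 b1 b2 where A: "A u X = vfun a1 a2" "A u Y = vfun b1 b2"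
    and SA: "schwartz a1" "schwartz a2" "schwartz b1" "schwartz b2"
    using assms A_S2[of u X] A_S2[of u Y] by (metis S2_E vfun_in_S2)
  \<comment> \<open>The derivative of s . Y in direction X is X . tau Y, which is symmetric in X and
    Y. Both sides of the identity therefore share the antiderivative of \<open>pz\<close>.\<close>
  define px py pz where "px = r * f + q * g" and "py = r * h + q * k" and "pz = g * h + f * k"
  define x y z where "x = Dinv px" and "y = Dinv py" and "z = Dinv pz"
  have Sp: "schwartz px" "schwartz py" "schwartz pz"
    using S by (simp_all add: px_def py_def pz_def smooth_simps)
  then have D: "bounded_smooth x" "bounded_smooth y" "bounded_smooth z"
    "deriv x = px" "deriv y = py" "deriv z = pz"
    by (simp_all add: x_def y_def z_def bounded_smooth_Dinv deriv_Dinv)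
  have pz: "k * f + h * g = pz"
    by (simp add: pz_def algebra_simps)
  define V1 V2 W1 W2 where
    "V1 = first_order_op k2 k3 (f * y + q * z)" and "V2 = first_order_op (- k2) k3 (g * y + r * z)" and
    "W1 = first_order_op k2 k3 (h * x + q * z)" and "W2 = first_order_op (- k2) k3 (k * x + r * z)"
  have SV: "schwartz V1" "schwartz V2" "schwartz W1" "schwartz W2"
    using S D by (simp_all add: V1_def V2_def W1_def W2_def smooth_simps schwartz_first_order_op)
  have a: "a1 = first_order_op k0 k1 f + first_order_op k2 k3 (q * x)"
    "a2 = first_order_op k0 (- k1) g + first_order_op (- k2) k3 (r * x)"
    "b1 = first_order_op k0 k1 h + first_order_op k2 k3 (q * y)"
    "b2 = first_order_op k0 (- k1) k + first_order_op (- k2) k3 (r * y)"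
    using A S unfolding eqs by (simp_all add: A_vfun vfun_eq_iff x_def y_def px_def py_def)
  define wa wb da db where "wa = Dinv (a2 * h + a1 * k)" and "wb = Dinv (b2 * f + b1 * g)"
    and "da = Dinv (r * V1 + q * V2)" and "db = Dinv (r * W1 + q * W2)"
  have W: "bounded_smooth wa" "bounded_smooth wb" "bounded_smooth da" "bounded_smooth db"
    using S SA SV by (simp_all add: wa_def wb_def da_def db_def smooth_simps)
  \<comment> \<open>In the difference of the nonlocal arguments the terms with \<open>k0\<close>,
    \<open>k2\<close> and \<open>z\<close> are symmetric under exchange of X and Y and cancel. The
    terms with \<open>k1\<close> give the derivative of \<open>f * k - g * h\<close>. Those with
    \<open>k3\<close> give \<open>x * deriv py - y * deriv px\<close>, which is the derivative of
    \<open>x * py - y * px\<close> because \<open>deriv x = px\<close> and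
    \<open>deriv y = py\<close>. As \<open>F\<close> is Schwartz, \<open>Dinv\<close> recovers it
    without a constant.\<close>
  define F where "F = const k1 (f * k - g * h) - const k3 (px * y - py * x)"
  have SF: "schwartz F"
    using S D Sp by (simp add: F_def smooth_simps)
  have "deriv F =
      const k1 ((deriv f * k + f * deriv k) - (deriv g * h + g * deriv h))
      - const k3 (((deriv r * f + r * deriv f) + (deriv q * g + q * deriv g)) * y + px * py
        - (((deriv r * h + r * deriv h) + (deriv q * k + q * deriv k)) * x + py * px))"
    using S D Sp
    by (simp add: F_def deriv_simps smooth_simps)
      (simp add: px_def py_def deriv_simps smooth_simps S)
  also have "\<dots> = ((a2 * h + a1 * k) - (r * V1 + q * V2)) - ((b2 * f + b1 * g) - (r * W1 + q * W2))"
    using S D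
    by (simp add: a V1_def V2_def W1_def W2_def first_order_op_def deriv_simps smooth_simps)
      (simp add: px_def py_def pz_def const_def fun_eq_iff algebra_simps)
  finally have "Dinv (((a2 * h + a1 * k) - (r * V1 + q * V2)) - ((b2 * f + b1 * g) - (r * W1 + q * W2))) = F"
    using Dinv_deriv[OF SF] by simp
  then have "(wa - da) - (wb - db) = F"
    using S SA SV by (simp add: Dinv_diff smooth_simps wa_def wb_def da_def db_def)
  \<comment> \<open>Eliminating one of the four antiderivatives suffices: the other three then
    cancel on both sides below.\<close>
  then have wa: "wa = F + da + (wb - db)"
    by (simp add: algebra_simps)
  \<comment> \<open>What is left is pointwise algebra. For \<open>k1\<close> it is
    \<open>f * py - h * px = q * (f * k - g * h)\<close>; for \<open>k3\<close> the terms
    \<open>q * px * y\<close> cancel and both sides become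
    \<open>deriv q * x * y + q * py * x\<close>.\<close>
  have eq1: "a1 * y + q * wa - first_order_op k0 k1 (f * y + q * z) - q * da
      = b1 * x + q * wb - first_order_op k0 k1 (h * x + q * z) - q * db"
    using S D unfolding wa F_def
    by (simp add: a first_order_op_def deriv_simps smooth_simps)
      (simp add: px_def py_def pz_def const_def fun_eq_iff algebra_simps)
  have eq2: "a2 * y + r * wa - first_order_op k0 (- k1) (g * y + r * z) - r * da
      = b2 * x + r * wb - first_order_op k0 (- k1) (k * x + r * z) - r * db"
    using S D unfolding wa F_def
    by (simp add: a first_order_op_def deriv_simps smooth_simps)
      (simp add: px_def py_def pz_def const_def fun_eq_iff algebra_simps)
  have gateaux: "gateaux A u (A u X) Y =
      vfun (first_order_op k2 k3 (a1 * y + q * wa)) (first_order_op (- k2) k3 (a2 * y + r * wa))"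
    "gateaux A u (A u Y) X =
      vfun (first_order_op k2 k3 (b1 * x + q * wb)) (first_order_op (- k2) k3 (b2 * x + r * wb))"
    unfolding A unfolding eqs
    using S SA by (simp_all add: gateaux_eq x_def y_def px_def py_def wa_def wb_def)
  have "gateaux A u X Y = vfun V1 V2" "gateaux A u Y X = vfun W1 W2"
    unfolding eqs using S
    by (simp_all add: gateaux_eq V1_def V2_def W1_def W2_def x_def y_def z_def px_def py_def pz
        pz_def[symmetric])
  then have AV: "A u (gateaux A u X Y) =
      vfun (first_order_op k2 k3 (first_order_op k0 k1 (f * y + q * z)) + first_order_op k2 k3 (q * da))
        (first_order_op (- k2) k3 (first_order_op k0 (- k1) (g * y + r * z)) + first_order_op (- k2) k3 (r * da))"
    "A u (gateaux A u Y X) =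
      vfun (first_order_op k2 k3 (first_order_op k0 k1 (h * x + q * z)) + first_order_op k2 k3 (q * db))
        (first_order_op (- k2) k3 (first_order_op k0 (- k1) (k * x + r * z)) + first_order_op (- k2) k3 (r * db))"
    using S SV D
    by (simp_all add: eqs A_vfun vfun_eq_iff da_def[symmetric] db_def[symmetric])
      (simp_all add: V1_def V2_def W1_def W2_def smooth_simps first_order_op_commute[of _ k0])
  show ?thesis
    unfolding gateaux AV vfun_diff vfun_eq_iff
  proof (intro conjI)
    show "first_order_op k2 k3 (a1 * y + q * wa)
        - (first_order_op k2 k3 (first_order_op k0 k1 (f * y + q * z)) + first_order_op k2 k3 (q * da))
      = first_order_op k2 k3 (b1 * x + q * wb)
        - (first_order_op k2 k3 (first_order_op k0 k1 (h * x + q * z)) + first_order_op k2 k3 (q * db))"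
      using arg_cong[OF eq1, of "first_order_op k2 k3"] S SA D W
      by (simp only: first_order_op_diff first_order_op_add smooth_simps schwartz_first_order_op diff_diff_eq)
    show "first_order_op (- k2) k3 (a2 * y + r * wa)
        - (first_order_op (- k2) k3 (first_order_op k0 (- k1) (g * y + r * z)) + first_order_op (- k2) k3 (r * da))
      = first_order_op (- k2) k3 (b2 * x + r * wb)
        - (first_order_op (- k2) k3 (first_order_op k0 (- k1) (k * x + r * z)) + first_order_op (- k2) k3 (r * db))"
      using arg_cong[OF eq2, of "first_order_op (- k2) k3"] S SA D W
      by (simp only: first_order_op_diff first_order_op_add smooth_simps schwartz_first_order_op diff_diff_eq)
  qed
qed

lemma hereditary_symmetry: "hereditary_symmetry A"
  unfolding hereditary_symmetry_def
  using linear gateaux_differentiable hereditary_identity by blast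

end

section \<open>The operator \<open>Phi\<close> and its explicit form\<close>

lemma Phi_op_eq:
  assumes "b2 \<noteq> 0" "u \<in> S2" "X \<in> S2"
  shows "Phi_op a1 a2 a3 b1 b2 u X = M_op a1 a2 a3 u (J_inv_formula b1 b2 u X)"
  using assms by (simp add: Phi_op_def inverse_op_J)

text \<open>In the constant of P u Dinv s^T, \<open>a2 * b1\<close> comes from sigma acting on the
  nonlocal part of J^-1 and \<open>- a1 * b2\<close> from the nonlocal part of M meeting the local
  part of J^-1. The product of both nonlocal parts, with its nested \<open>Dinv\<close>, is zero by
  v . s = 0. The derivative term of M yields \<open>a3 / b2\<close> and, since tau s = u,
  \<open>a3 * b1 / b2\<^sup>2\<close>.\<close>

lemma Phi_op_vfun:
  assumes b2: "b2 \<noteq> 0"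
    and S: "schwartz q" "schwartz r" "schwartz f" "schwartz g"
  shows "Phi_op a1 a2 a3 b1 b2 (vfun q r) (vfun f g) =
    vfun (first_order_op (a2 / b2) (a3 / b2) f
        + first_order_op ((a2 * b1 - a1 * b2) / b2\<^sup>2) (a3 * b1 / b2\<^sup>2) (q * Dinv (r * f + q * g)))
      (first_order_op (a2 / b2) (- (a3 / b2)) g
        + first_order_op (- ((a2 * b1 - a1 * b2) / b2\<^sup>2)) (a3 * b1 / b2\<^sup>2) (r * Dinv (r * f + q * g)))"
proof -
  define y where "y = Dinv (r * f + q * g)"
  have y: "bounded_smooth y"
    using S by (simp add: y_def smooth_simps)
  have arg: "q * const (1 / b2\<^sup>2) (const b1 (r * y) - const b2 g)
      - r * const (1 / b2\<^sup>2) (const b1 (q * y) + const b2 f) = const (- 1 / b2) (r * f + q * g)"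
    using b2 by (auto simp: const_def fun_eq_iff field_simps power2_eq_square)
  show ?thesis
    using S y b2
    by (simp add: Phi_op_eq J_inv_formula_vfun M_op_vfun smooth_simps y_def[symmetric] arg Dinv_const
        vfun_eq_iff first_order_op_def deriv_fun_diff deriv_fun_add deriv_fun_const)
      (simp add: const_def fun_eq_iff field_simps power2_eq_square)
qed

lemma Phi_formula_vfun:
  assumes S: "schwartz q" "schwartz r" "schwartz f" "schwartz g"
  shows "Phi_formula a1 a2 a3 b1 b2 (vfun q r) (vfun f g) =
    vscale (1 / b2\<^sup>2) (vfun
      (const (a2 * b2) f + const (a3 * b2) (deriv f)
        + const (a2 * b1 - a1 * b2) (q * Dinv (r * f + q * g))
        + const (a3 * b1) (deriv (q * Dinv (r * f + q * g))))
      (const (a2 * b2) g - const (a3 * b2) (deriv g)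
        + const (a1 * b2 - a2 * b1) (r * Dinv (r * f + q * g))
        + const (a3 * b1) (deriv (r * Dinv (r * f + q * g)))))"
proof -
  have "Phi_formula a1 a2 a3 b1 b2 (vfun q r) (vfun f g) = vscale (1 / b2\<^sup>2) (vfun
      (const (a2 * b2) f + const (a3 * b2) (deriv f)
        + const (a2 * b1 - a1 * b2) (q * Dinv (r * f)) + const (a3 * b1) (deriv (q * Dinv (r * f)))
        + (const (a2 * b1 - a1 * b2) (q * Dinv (q * g)) + const (a3 * b1) (deriv (q * Dinv (q * g)))))
      (const (a1 * b2 - a2 * b1) (r * Dinv (r * f)) + const (a3 * b1) (deriv (r * Dinv (r * f)))
        + (const (a2 * b2) g - const (a3 * b2) (deriv g)
        + const (a1 * b2 - a2 * b1) (r * Dinv (q * g)) + const (a3 * b1) (deriv (r * Dinv (q * g))))))"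
    by (simp only: Phi_formula_def vfun_def matrix_op_def Let_def mult_def[abs_def] times_fun_def
        const_def[abs_def] fun_diff_def plus_fun_def o_def fst_conv snd_conv)
  moreover have "deriv (p * Dinv (r * f + q * g)) = deriv (p * Dinv (r * f)) + deriv (p * Dinv (q * g))"
    if "schwartz p" for p
    using S that by (simp add: Dinv_add smooth_simps distrib_left deriv_fun_add)
  ultimately show ?thesis
    using S by (simp add: vscale_vfun vfun_eq_iff Dinv_add smooth_simps)
      (simp add: const_def fun_eq_iff algebra_simps)
qed

lemma Phi_op_eq_formula:
  assumes "b2 \<noteq> 0" "u \<in> S2" "X \<in> S2"
  shows "Phi_op a1 a2 a3 b1 b2 u X = Phi_formula a1 a2 a3 b1 b2 u X"
proof -
  obtain q r f g where eqs: "u = vfun q r" "X = vfun f g"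
    and S: "schwartz q" "schwartz r" "schwartz f" "schwartz g"
    using assms(2,3) by (metis S2_E)
  show ?thesis
    using assms(1) unfolding eqs Phi_op_vfun[OF assms(1) S] Phi_formula_vfun[OF S]
      vscale_vfun vfun_eq_iff
    by (simp add: first_order_op_def const_def fun_eq_iff field_simps power2_eq_square)
qed

lemma hereditary_symmetry_Phi:
  assumes "b2 \<noteq> 0"
  shows "hereditary_symmetry (Phi_op a1 a2 a3 b1 b2)"
proof -
  interpret recursion_operator "Phi_op a1 a2 a3 b1 b2" "a2 / b2" "a3 / b2"
    "(a2 * b1 - a1 * b2) / b2\<^sup>2" "a3 * b1 / b2\<^sup>2"
    by standard (rule Phi_op_vfun[OF assms])
  show ?thesis
    by (rule hereditary_symmetry)
qed

theorem mainTheorem2: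
  fixes \<alpha>1 \<alpha>2 \<alpha>3 \<beta>1 \<beta>2 :: real
  assumes "\<beta>2 \<noteq> 0"
  shows "hamiltonian_pair (J_op \<beta>1 \<beta>2) (M_op \<alpha>1 \<alpha>2 \<alpha>3) \<and>
         invertible_op (J_op \<beta>1 \<beta>2) \<and>
         (\<forall>u\<in>S2. \<forall>X\<in>S2. inverse_op (J_op \<beta>1 \<beta>2) u X = J_inv_formula \<beta>1 \<beta>2 u X) \<and>
         hereditary_symmetry (Phi_op \<alpha>1 \<alpha>2 \<alpha>3 \<beta>1 \<beta>2) \<and>
         (\<forall>u\<in>S2. \<forall>X\<in>S2.
            Phi_op \<alpha>1 \<alpha>2 \<alpha>3 \<beta>1 \<beta>2 u X = Phi_formula \<alpha>1 \<alpha>2 \<alpha>3 \<beta>1 \<beta>2 u X)"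
  using assms
  by (simp add: invertible_op_def hamiltonian_pair_J_M bij_betw_J inverse_op_J
      hereditary_symmetry_Phi Phi_op_eq_formula)

end
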